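(* For $0<p<1$, $s<r<1/p$, $a_n\ge 0$, we have $$\sum_{n=1}^{\infty}\left(n^{-s}\sum_{k=n}^{\infty}\frac{a_k}{k^{1-s}}\right)^p\le\sum_{n=1}^{\infty}\left(n^{-r}\sum_{k=n}^{\infty}\frac{a_k}{k^{1-r}}\right)^p<\left(\frac{1-sp}{1-rp}\right)\sum_{n=1}^{\infty}\left(n^{-s}\sum_{k=n}^{\infty}\frac{a_k}{k^{1-s}}\right)^p .$$ The constants are best possible.
   Context: Here $p,r,s$ are real numbers and $(a_n)_{n\ge1}$ is any sequence of non-negative real numbers. The constants referred to are the constant $1$ in the first inequality and the constant $\frac{1-sp}{1-rp}$ in the second.
   Formalization: The strict inequality is stated for sequences that are not identically zero and whose sum with exponent s is finite; for the zero sequence it would read 0 < 0, and for an infinite sum ∞ < ∞. *)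

theory Defs
  imports "HOL-Analysis.Analysis"
begin

text \<open>
  The sums range over non-negative terms and need not converge, so they are taken in
  \<^typ>\<open>ennreal\<close>. The library has no real powers on that type; the following agrees with
  the real power on finite values and sends infinity to itself, which is the right
  convention only for a positive exponent.
\<close>

definition ennpowr :: "ennreal \<Rightarrow> real \<Rightarrow> ennreal" where
  "ennpowr x p = (if x = \<infinity> then \<infinity> else ennreal (enn2real x powr p))"

text \<open>
  Sequences are indexed from 1, so the value \<^term>\<open>a 0\<close> is never used. The index of the
  inner sum is \<^term>\<open>k = n + j\<close>, that of the outer sum is \<^term>\<open>n = Suc m\<close>.
\<close>

definition tail_term :: "real \<Rightarrow> (nat \<Rightarrow> real) \<Rightarrow> nat \<Rightarrow> ennreal" where
  "tail_term s a n =
     ennreal (real n powr (- s)) * (\<Sum>j. ennreal (a (n + j) / real (n + j) powr (1 - s)))"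

definition tail_sum :: "real \<Rightarrow> real \<Rightarrow> (nat \<Rightarrow> real) \<Rightarrow> ennreal" where
  "tail_sum p s a = (\<Sum>m. ennpowr (tail_term s a (Suc m)) p)"

definition nonneg_seq :: "(nat \<Rightarrow> real) \<Rightarrow> bool" where
  "nonneg_seq a \<longleftrightarrow> (\<forall>n\<ge>1. 0 \<le> a n)"

text \<open>
  A strict inequality between the sums can only be meant for sequences that are not
  identically zero and for which the sums are finite. Finiteness is required of the sum
  with parameter \<^term>\<open>s\<close> only.
\<close>

definition admissible :: "real \<Rightarrow> real \<Rightarrow> (nat \<Rightarrow> real) \<Rightarrow> bool" where
  "admissible p s a \<longleftrightarrow> nonneg_seq a \<and> (\<exists>n\<ge>1. a n \<noteq> 0) \<and> tail_sum p s a < \<infinity>"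

end

theory Submission
  imports Defs "HOL-Real_Asymp.Real_Asymp"
begin

text \<open>
  Put \<open>c\<^sub>k = a\<^sub>k / k\<^bsup>1-s\<^esup>\<close>, \<open>A\<^sub>n = \<Sum>\<^bsub>k\<ge>n\<^esub> c\<^sub>k\<close> and
  \<open>d\<^sub>k = A\<^sub>k\<^sup>p - A\<^bsub>k+1\<^esub>\<^sup>p\<close>. The first inequality holds term by term. For the second one,
  concavity of \<open>x\<^sup>p\<close> gives \<open>(\<Sum>\<^bsub>k\<ge>n\<^esub> k\<^bsup>r-s\<^esup> c\<^sub>k)\<^sup>p \<le> \<Sum>\<^bsub>k\<ge>n\<^esub> k\<^bsup>(r-s)p\<^esup> d\<^sub>k\<close>. Interchanging
  the order of summation turns both sides of the claim into sums over \<open>k\<close> with weights \<open>d\<^sub>k\<close>,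
  and it remains to compare, for each \<open>k\<close>, the sums \<open>k\<^bsup>(r-s)p\<^esup> \<Sum>\<^bsub>n\<le>k\<^esub> n\<^bsup>-rp\<^esup>\<close> and
  \<open>\<Sum>\<^bsub>n\<le>k\<^esub> n\<^bsup>-sp\<^esup>\<close>. These are the two sides for a sequence with a single nonzero term, up to
  a common factor, and their ratio tends to the constant; hence the constant is best possible.
\<close>

section \<open>Elementary bounds for \<open>ln (1 + 1 / u)\<close>\<close>

lemma two_mult_le_exp_diff:
  fixes w :: real
  assumes "0 \<le> w"
  shows "2 * w \<le> exp w - exp (- w)"
proof -
  let ?f = "\<lambda>w::real. exp w - exp (- w) - 2 * w"
  have "?f 0 \<le> ?f w"
  proof (rule DERIV_nonneg_imp_nondecreasing[OF assms])
    fix x :: real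
    have "(?f has_real_derivative exp x + exp (- x) - 2) (at x)"
      by (auto intro!: derivative_eq_intros)
    moreover have "exp x + exp (- x) - 2 \<ge> 0"
      using exp_ge_add_one_self[of x] exp_ge_add_one_self[of "-x"] by linarith
    ultimately show "\<exists>y. (?f has_real_derivative y) (at x) \<and> 0 \<le> y" by blast
  qed
  then show ?thesis by simp
qed

text \<open>With \<open>l = ln (1 + 1 / u)\<close> the right side is
  \<open>exp l + exp (- l) - 2\<close>, the square of \<open>exp (l / 2) - exp (- (l / 2))\<close>,
  so the preceding bound applies at \<open>l / 2\<close>.\<close>

lemma ln_one_plus_inverse_square_le:
  fixes u :: real
  assumes "0 < u"
  shows "(ln (1 + 1 / u))\<^sup>2 \<le> 1 / (u * (u + 1))"
proof -
  define l where "l = ln (1 + 1 / u)"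
  have l: "0 < l" and e: "exp l = 1 + 1 / u"
    using assms by (auto simp: l_def add_pos_pos)
  have "(2 * (l / 2))\<^sup>2 \<le> (exp (l / 2) - exp (- (l / 2)))\<^sup>2"
    using two_mult_le_exp_diff[of "l / 2"] l by (intro power_mono) auto
  also have "\<dots> = exp l + exp (- l) - 2"
    by (simp add: power2_eq_square algebra_simps flip: exp_add)
  also have "\<dots> = 1 / (u * (u + 1))"
  proof -
    have "u + 1 \<noteq> 0" using assms by simp
    then show ?thesis using assms
      by (simp add: e exp_minus add_frac_eq divide_simps) (simp add: algebra_simps)
  qed
  finally show ?thesis by (simp add: l_def)
qed

text \<open>The derivative of \<open>1 / ln (1 + 1 / u)\<close> is \<open>1 / (u * (u + 1))\<close>
  divided by the squared logarithm, hence at least 1 by the previous estimate.\<close>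

lemma inverse_ln_one_plus_inverse_step:
  fixes v w :: real
  assumes "0 < v" "v \<le> w"
  shows "1 / ln (1 + 1 / v) + (w - v) \<le> 1 / ln (1 + 1 / w)"
proof -
  let ?f = "\<lambda>u::real. 1 / ln (1 + 1 / u) - u"
  have "?f v \<le> ?f w"
  proof (rule DERIV_nonneg_imp_nondecreasing[OF assms(2)])
    fix u assume "v \<le> u" "u \<le> w"
    then have u: "0 < u" using assms by simp
    then have l: "0 < ln (1 + 1 / u)" by (intro ln_gt_zero) simp
    have "((\<lambda>u. ln (1 + 1 / u)) has_real_derivative
        inverse (1 + 1 / u) * (- (1 / (u * u)))) (at u)"
      using u by (auto intro!: derivative_eq_intros simp: add_pos_pos divide_inverse mult_ac)
    also have "inverse (1 + 1 / u) * (- (1 / (u * u))) = - (1 / (u * (u + 1)))"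
      using u by (simp add: add_pos_pos divide_simps)
    finally have D: "((\<lambda>u. ln (1 + 1 / u)) has_real_derivative - (1 / (u * (u + 1)))) (at u)" .
    have "(?f has_real_derivative (1 / (u * (u + 1))) / (ln (1 + 1 / u))\<^sup>2 - 1) (at u)"
      using DERIV_diff[OF DERIV_divide[OF DERIV_const[of 1] D] DERIV_ident] l
      by (simp add: power2_eq_square)
    moreover have "1 \<le> (1 / (u * (u + 1))) / (ln (1 + 1 / u))\<^sup>2"
      using ln_one_plus_inverse_square_le[OF u] l by (subst le_divide_eq_1_pos) simp_all
    then have "(1 / (u * (u + 1))) / (ln (1 + 1 / u))\<^sup>2 - 1 \<ge> 0" by simp
    ultimately show "\<exists>y. (?f has_real_derivative y) (at u) \<and> 0 \<le> y" by blast
  qed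
  then show ?thesis by simp
qed

section \<open>Power sums and the comparison of the weights\<close>

text \<open>With the exponent shifted by 1, the sum grows like \<open>n powr g / g\<close> for
  positive \<open>g\<close>; the weights \<open>n powr (- (r * p))\<close> belong to
  \<open>g = 1 - r * p\<close>.\<close>

definition power_sum :: "real \<Rightarrow> nat \<Rightarrow> real" where
  "power_sum g n = (\<Sum>k=1..n. real k powr (g - 1))"

lemma power_sum_0 [simp]: "power_sum g 0 = 0"
  by (simp add: power_sum_def)

lemma power_sum_Suc [simp]: "power_sum g (Suc n) = power_sum g n + real (Suc n) powr (g - 1)"
  by (simp add: power_sum_def)

lemma power_sum_nonneg: "0 \<le> power_sum g n"
  by (auto simp: power_sum_def intro: sum_nonneg)

lemma power_sum_pos: "n \<ge> 1 \<Longrightarrow> 0 < power_sum g n"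
  by (auto simp: power_sum_def intro!: sum_pos)

text \<open>
  The logarithm makes the bound sharp enough for every exponent: the induction step reduces, by
  \<open>1 + z \<le> exp z\<close>, to \<open>1 / ln (1 + 1 / (M - 1)) + 1 \<le> 1 / ln (1 + 1 / M)\<close>, which no longer involves \<open>g\<close>.
\<close>
lemma power_sum_upper:
  assumes "0 < g"
  shows "g * power_sum g (Suc m) \<le> real (m + 2) powr (g - 1) / ln (1 + 1 / real (Suc m))"
proof (induction m)
  case 0
  \<comment> \<open>This choice of point gives \<open>exp 1 * (g * ln 2) \<le> 2 powr g\<close>,
    after which \<open>2 \<le> exp 1\<close> suffices.\<close>
  have "1 + (g * ln 2 - 1) \<le> exp (g * ln 2 - 1)"
    by (rule exp_ge_add_one_self)
  then have "exp 1 * (g * ln 2) \<le> exp 1 * exp (g * ln 2 - 1)"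
    by (intro mult_left_mono) auto
  also have "\<dots> = 2 powr g"
    by (simp add: powr_def flip: exp_add)
  finally have "exp 1 * (g * ln 2) \<le> 2 powr g" .
  moreover have "2 * (g * ln 2) \<le> exp 1 * (g * ln 2)"
    using exp_ge_add_one_self[of 1] assms by (intro mult_right_mono) auto
  ultimately have "g * ln 2 \<le> 2 powr (g - 1)"
    by (simp add: powr_diff)
  then show ?case by (simp add: le_divide_eq)
next
  case (Suc m)
  define M where "M = real (m + 2)"
  have M: "M \<ge> 2" "real (Suc m) = M - 1" "real (Suc m + 2) = M + 1" "real (Suc (Suc m)) = M"
    by (auto simp: M_def)
  define x where "x = ln (1 + 1 / M)"
  define y where "y = ln (1 + 1 / (M - 1))"
  have xy: "0 < x" "0 < y" using M by (auto simp: x_def y_def intro!: ln_gt_zero)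
  have s: "1 / y + 1 \<le> 1 / x"
    using inverse_ln_one_plus_inverse_step[of "M - 1" M] M by (simp add: x_def y_def)
  have q: "(M + 1) powr (g - 1) = M powr (g - 1) * exp ((g - 1) * x)"
  proof -
    have "M + 1 = M * exp x" using M by (simp add: x_def add_pos_pos field_simps)
    then show ?thesis using M by (simp add: powr_mult exp_powr_real mult.commute)
  qed
  have "g + 1 / y \<le> (1 + (g - 1) * x) / x"
    using s xy by (simp add: add_divide_distrib)
  also have "\<dots> \<le> exp ((g - 1) * x) / x"
    using xy by (intro divide_right_mono exp_ge_add_one_self) auto
  finally have "M powr (g - 1) * (g + 1 / y) \<le> M powr (g - 1) * (exp ((g - 1) * x) / x)"
    by (intro mult_left_mono) auto
  moreover have "g * power_sum g (Suc m) \<le> M powr (g - 1) / y"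
    using Suc.IH M by (simp add: y_def M_def)
  ultimately have "g * (power_sum g (Suc m) + M powr (g - 1)) \<le> M powr (g - 1) * (exp ((g - 1) * x) / x)"
    by (simp only: distrib_left mult.commute[of g "M powr (g - 1)"]) simp
  then have "g * (power_sum g (Suc m) + M powr (g - 1)) \<le> (M + 1) powr (g - 1) / x"
    by (simp only: q times_divide_eq_right)
  then show ?case using M by (simp only: power_sum_Suc[of _ "Suc m"] x_def)
qed

text \<open>Induction on \<open>n\<close>, starting from \<open>1 < b / g\<close>. The tangent bound
  for \<open>exp\<close> estimates the increment of \<open>n powr t\<close> with a factor
  \<open>ln (1 + 1 / n)\<close>, which cancels against the logarithm in
  \<open>power_sum_upper\<close>. The left side then grows by at most
  \<open>(t / g + 1) * real (Suc n) powr (b - 1)\<close>, and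
  \<open>t / g + 1 = b / g\<close>.\<close>

lemma power_sum_ratio_less:
  assumes "0 < g" "g < b" "n \<ge> 1"
  shows "real n powr (b - g) * power_sum g n < b / g * power_sum b n"
  using \<open>n \<ge> 1\<close>
proof (induction n rule: dec_induct)
  case base
  then show ?case using assms by simp
next
  case (step n)
  define t x where "t = b - g" and "x = ln (1 + 1 / real n)"
  have n: "real n > 0" using step by simp
  have t: "t > 0" and x: "x > 0" using assms n by (auto simp: t_def x_def intro!: ln_gt_zero)
  have e: "real n = real (Suc n) * exp (- x)"
    using n by (simp add: x_def exp_minus field_simps)
  have "real n powr t = real (Suc n) powr t * exp (- (t * x))"
    by (subst e) (simp add: powr_mult exp_powr_real mult.commute)
  moreover have "1 - t * x \<le> exp (- (t * x))"
    using exp_ge_add_one_self[of "- (t * x)"] by simp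
  ultimately have d: "real (Suc n) powr t - real n powr t \<le> real (Suc n) powr t * (t * x)"
    using mult_left_mono[of "1 - t * x" "exp (- (t * x))" "real (Suc n) powr t"]
    by (simp add: algebra_simps)
  obtain m where m: "n = Suc m" using step by (cases n) auto
  have u: "power_sum g n * x \<le> real (Suc n) powr (g - 1) / g"
    using power_sum_upper[OF assms(1), of m] x assms(1) m
    by (simp add: x_def field_simps)
  have "(real (Suc n) powr t - real n powr t) * power_sum g n
      \<le> (real (Suc n) powr t * (t * x)) * power_sum g n"
    using d power_sum_nonneg by (rule mult_right_mono)
  also have "\<dots> = (real (Suc n) powr t * t) * (power_sum g n * x)" by simp
  also have "\<dots> \<le> (real (Suc n) powr t * t) * (real (Suc n) powr (g - 1) / g)"
    using u t by (intro mult_left_mono) auto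
  also have "\<dots> = t / g * real (Suc n) powr (b - 1)"
    by (simp add: t_def flip: powr_add)
  finally have A: "(real (Suc n) powr t - real n powr t) * power_sum g n
      \<le> t / g * real (Suc n) powr (b - 1)" .
  have "real (Suc n) powr t * real (Suc n) powr (g - 1) = real (Suc n) powr (b - 1)"
    by (simp add: t_def flip: powr_add)
  then have "real (Suc n) powr t * power_sum g (Suc n) = real n powr t * power_sum g n
     + (real (Suc n) powr t - real n powr t) * power_sum g n + real (Suc n) powr (b - 1)"
    by (simp add: algebra_simps)
  also have "\<dots> < b / g * power_sum b n + (t / g + 1) * real (Suc n) powr (b - 1)"
    using step.IH A by (simp add: t_def algebra_simps)
  also have "t / g + 1 = b / g" using assms by (simp add: t_def field_simps)
  finally show ?case by (simp add: t_def algebra_simps)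
qed

lemma powr_le_tangent:
  fixes y g :: real
  assumes "0 \<le> y" "0 < g" "g \<le> 1"
  shows "y powr g \<le> 1 + g * (y - 1)"
  using Youngs_inequality_0[of g "1 - g" y 1] assms by (cases "y = 0") (simp_all add: algebra_simps)

text \<open>This is the concave case for the exponent \<open>1 / g\<close> at the point
  \<open>y powr g\<close>.\<close>

lemma powr_ge_tangent:
  fixes y g :: real
  assumes "0 \<le> y" "1 \<le> g"
  shows "1 + g * (y - 1) \<le> y powr g"
proof -
  have "(y powr g) powr (1 / g) \<le> 1 + (1 / g) * (y powr g - 1)"
    using assms by (intro powr_le_tangent) auto
  then have "g * y \<le> g * (1 + (1 / g) * (y powr g - 1))"
    using assms by (intro mult_left_mono) (auto simp: powr_powr)
  then show ?thesis using assms by (simp add: algebra_simps)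
qed

text \<open>The tangent bounds compare \<open>g * N powr (g - 1)\<close> with an increment of
  \<open>x powr g\<close>: the one ending at \<open>N\<close> if \<open>1 \<le> g\<close>, the one
  starting at \<open>N\<close> otherwise. Telescoping the latter from 1 produces the
  \<open>- 1\<close>.\<close>

lemma power_sum_lower:
  assumes "0 < g"
  shows "real n powr g - 1 \<le> g * power_sum g n"
proof (cases "1 \<le> g")
  case True
  have "real n powr g \<le> g * power_sum g n"
  proof (induction n)
    case (Suc n)
    define N where "N = real (Suc n)"
    have N: "N \<ge> 1" "real n = N - 1" by (auto simp: N_def)
    have "N powr g * (1 + g * ((N - 1) / N - 1)) \<le> N powr g * ((N - 1) / N) powr g"
      using powr_ge_tangent[of "(N - 1) / N" g] N True by (intro mult_left_mono) auto
    also have "\<dots> = (N - 1) powr g" using N by (simp flip: powr_mult)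
    also have "N powr g * (1 + g * ((N - 1) / N - 1)) = N powr g - g * N powr (g - 1)"
      using N by (simp add: powr_diff field_simps)
    finally show ?case using Suc N by (simp add: algebra_simps flip: N_def)
  qed auto
  then show ?thesis by linarith
next
  case False
  have "real (Suc n) powr g - 1 \<le> g * power_sum g n"
  proof (induction n)
    case (Suc n)
    define N where "N = real (Suc n)"
    have N: "N \<ge> 1" "real (Suc (Suc n)) = N + 1" by (auto simp: N_def)
    have "N powr g * ((N + 1) / N) powr g \<le> N powr g * (1 + g * ((N + 1) / N - 1))"
      using powr_le_tangent[of "(N + 1) / N" g] N False assms by (intro mult_left_mono) auto
    also have "\<dots> = N powr g + g * N powr (g - 1)"
      using N by (simp add: powr_diff field_simps)
    also have "N powr g * ((N + 1) / N) powr g = (N + 1) powr g"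
      using N by (simp flip: powr_mult)
    finally show ?case using Suc N by (simp add: algebra_simps flip: N_def)
  qed auto
  moreover have "real n powr g \<le> real (Suc n) powr g"
    using assms by (intro powr_mono2) auto
  ultimately show ?thesis by linarith
qed

lemma power_sum_asymp:
  assumes "0 < g"
  shows "(\<lambda>n. g * power_sum g (Suc n) / real (Suc n) powr g) \<longlonglongrightarrow> 1"
proof (rule tendsto_sandwich)
  show "(\<lambda>n. (real (Suc n) powr g - 1) / real (Suc n) powr g) \<longlonglongrightarrow> 1"
    using assms by real_asymp
  show "(\<lambda>n. real (n + 2) powr (g - 1) / ln (1 + 1 / real (Suc n)) / real (Suc n) powr g)
      \<longlonglongrightarrow> 1"
    using assms by real_asymp
qed (intro always_eventually allI divide_right_mono power_sum_lower power_sum_upper assms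
      powr_ge_zero)+

lemma power_sum_ratio_tendsto:
  assumes "0 < g" "0 < b"
  shows "(\<lambda>n. real (Suc n) powr (b - g) * power_sum g (Suc n) / power_sum b (Suc n))
     \<longlonglongrightarrow> b / g"
proof -
  have "(\<lambda>n. b / g * ((g * power_sum g (Suc n) / real (Suc n) powr g)
            / (b * power_sum b (Suc n) / real (Suc n) powr b))) \<longlonglongrightarrow> b / g * (1 / 1)"
    using assms by (intro tendsto_intros power_sum_asymp) auto
  moreover have "b / g * ((g * power_sum g (Suc n) / real (Suc n) powr g)
            / (b * power_sum b (Suc n) / real (Suc n) powr b))
      = real (Suc n) powr (b - g) * power_sum g (Suc n) / power_sum b (Suc n)" for n
    using assms power_sum_pos[of "Suc n" b]
    by (simp add: powr_diff field_simps del: power_sum_Suc of_nat_Suc)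
  ultimately show ?thesis by simp
qed


section \<open>Concavity of \<open>x powr p\<close> and weighted step sums\<close>

lemma powr_increment_antimono:
  fixes p q b u :: real
  assumes "0 < p" "p \<le> 1" "0 \<le> q" "q \<le> b" "0 \<le> u"
  shows "(b + u) powr p - b powr p \<le> (q + u) powr p - q powr p"
proof -
  let ?f = "\<lambda>x. (x + u) powr p - x powr p"
  have "?f q \<ge> ?f b"
  \<comment> \<open>Only the open interval is differentiated over, since \<open>x powr p\<close> may
    fail to be differentiable at 0, which is allowed as left endpoint.\<close>
  proof (rule DERIV_nonpos_imp_decreasing_open[OF assms(4)])
    fix x assume "q < x" "x < b"
    then have x: "0 < x" using assms by simp
    then have "(?f has_real_derivative p * (x + u) powr (p - 1) - p * x powr (p - 1)) (at x)"
      using assms by (auto intro!: derivative_eq_intros)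
    moreover have "(x + u) powr (p - 1) \<le> x powr (p - 1)"
      using x assms by (intro powr_mono2') auto
    ultimately show "\<exists>y. (?f has_real_derivative y) (at x) \<and> y \<le> 0"
      using assms by (intro exI[of _ "p * (x + u) powr (p - 1) - p * x powr (p - 1)"])
        (auto intro: mult_left_mono)
  next
    show "continuous_on {q..b} ?f"
      using assms by (intro continuous_intros continuous_on_powr') auto
  qed
  then show ?thesis .
qed

text \<open>
  The function \<open>A\<close> is a superposition of the step functions \<open>k \<mapsto> [k \<le> j]\<close> with weights
  \<open>A j - A (Suc j)\<close>; the inequality is an equality for a single step function, and the
  general case follows from the concavity of \<open>x powr p\<close>. The last summand accounts for the
  mass of \<open>A\<close> beyond the cut-off.
\<close>
lemma weighted_step_sum_powr_le:
  fixes A :: "nat \<Rightarrow> real"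
  assumes "0 < p" "p \<le> 1" "0 \<le> t"
    and A: "\<And>k. 0 \<le> A k" "\<And>k. A (Suc k) \<le> A k"
  shows "((\<Sum>j<m. real (n + j) powr t * (A (n + j) - A (Suc (n + j))))
      + real (n + m) powr t * A (n + m)) powr p
    \<le> (\<Sum>j<m. real (n + j) powr (t * p) * (A (n + j) powr p - A (Suc (n + j)) powr p))
      + real (n + m) powr (t * p) * A (n + m) powr p"
proof (induction m arbitrary: n)
  case 0
  then show ?case using A by (simp add: powr_mult powr_powr)
next
  case (Suc m)
  define B where "B = (\<Sum>j<m. real (Suc n + j) powr t * (A (Suc n + j) - A (Suc (Suc n + j))))
      + real (Suc n + m) powr t * A (Suc n + m)"
  define E where "E = (\<Sum>j<m. real (Suc n + j) powr (t * p)
        * (A (Suc n + j) powr p - A (Suc (Suc n + j)) powr p))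
      + real (Suc n + m) powr (t * p) * A (Suc n + m) powr p"
  define N where "N = real n powr t"
  have N: "0 \<le> N" by (simp add: N_def)
  \<comment> \<open>All weights in \<open>B\<close> are at least \<open>N\<close>; with constant
    weight \<open>N\<close> the sum telescopes to \<open>N * A (Suc n)\<close>.\<close>
  have B: "N * A (Suc n) \<le> B"
  proof -
    have "(\<Sum>j<m. A (Suc n + j) - A (Suc (Suc n + j))) = A (Suc n) - A (Suc n + m)"
      by (induction m) auto
    then have "N * A (Suc n) = (\<Sum>j<m. N * (A (Suc n + j) - A (Suc (Suc n + j)))) + N * A (Suc n + m)"
      by (simp only: sum_distrib_left[symmetric] distrib_left[symmetric]) simp
    also have "\<dots> \<le> B"
      unfolding B_def N_def using A assms(3)
      by (intro add_mono sum_mono mult_right_mono powr_mono2) auto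
    finally show ?thesis .
  qed
  have Np: "N powr p = real n powr (t * p)" by (simp add: N_def powr_powr)
  \<comment> \<open>Moving the base point from \<open>B\<close> down to \<open>N * A (Suc n)\<close>
    can only enlarge the increment of \<open>x powr p\<close>, and the new increment is exactly the
    term of index \<open>n\<close> on the right.\<close>
  have "(B + N * (A n - A (Suc n))) powr p
      \<le> B powr p + ((N * A (Suc n) + N * (A n - A (Suc n))) powr p - (N * A (Suc n)) powr p)"
    using powr_increment_antimono[OF assms(1,2) _ B, of "N * (A n - A (Suc n))"] A N by simp
  also have "N * A (Suc n) + N * (A n - A (Suc n)) = N * A n" by (simp add: algebra_simps)
  also have "(N * A n) powr p - (N * A (Suc n)) powr p = real n powr (t * p) * (A n powr p - A (Suc n) powr p)"
    using N A by (simp add: powr_mult Np algebra_simps)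
  also have "B powr p \<le> E"
    using Suc.IH[of "Suc n"] by (simp only: B_def E_def)
  finally show ?case
    by (simp only: B_def E_def N_def sum.lessThan_Suc_shift o_def) (simp add: algebra_simps)
qed

section \<open>Powers and series in \<open>ennreal\<close>\<close>

lemma ennpowr_ennreal: "0 \<le> x \<Longrightarrow> ennpowr (ennreal x) p = ennreal (x powr p)"
  by (simp add: ennpowr_def)

lemma ennpowr_top [simp]: "ennpowr \<infinity> p = \<infinity>" "ennpowr top p = top"
  by (simp_all add: ennpowr_def)

lemma ennpowr_mono:
  assumes "0 \<le> p" "x \<le> y"
  shows "ennpowr x p \<le> ennpowr y p"
  using assms
  by (cases x; cases y) (auto simp: ennpowr_ennreal top_unique intro!: ennreal_leI powr_mono2)

lemma ennpowr_cmult: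
  assumes "0 < u"
  shows "ennpowr (ennreal u * x) p = ennreal (u powr p) * ennpowr x p"
  using assms
  by (cases x) (auto simp: ennpowr_ennreal powr_mult ennreal_mult_top simp flip: ennreal_mult)

text \<open>Raising the hypothesis to the power \<open>1 / p\<close> bounds the partial sums
  themselves, hence the series; monotonicity of \<open>ennpowr\<close> then leads back to
  \<open>E\<close>.\<close>

lemma ennpowr_suminf_le:
  fixes f :: "nat \<Rightarrow> real"
  assumes "0 < p" "\<And>j. 0 \<le> f j" "\<And>m. ennreal ((\<Sum>j<m. f j) powr p) \<le> E"
  shows "ennpowr (\<Sum>j. ennreal (f j)) p \<le> E"
proof (cases E)
  case (real e)
  have "(\<Sum>j. ennreal (f j)) \<le> ennreal (e powr (1 / p))"
  proof (rule suminf_le_const)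
    fix m
    have "(\<Sum>j<m. f j) powr p \<le> e" using assms(3)[of m] real by simp
    then have "((\<Sum>j<m. f j) powr p) powr (1 / p) \<le> e powr (1 / p)"
      using assms by (intro powr_mono2) auto
    then show "(\<Sum>j<m. ennreal (f j)) \<le> ennreal (e powr (1 / p))"
      using assms by (simp add: powr_powr sum_nonneg sum_ennreal ennreal_leI)
  qed simp
  then have "ennpowr (\<Sum>j. ennreal (f j)) p \<le> ennpowr (ennreal (e powr (1 / p))) p"
    using assms(1) by (intro ennpowr_mono) auto
  also have "\<dots> = E" using real assms(1) by (simp add: ennpowr_ennreal powr_powr)
  finally show ?thesis .
qed simp

lemma suminf_ennreal_offset:
  fixes f :: "nat \<Rightarrow> ennreal"
  shows "(\<Sum>j<m. f j) + (\<Sum>j. f (j + m)) = (\<Sum>j. f j)"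
  using suminf_offset[of f m] by (simp add: add.commute)

lemma suminf_ennreal_swap:
  fixes f :: "nat \<Rightarrow> nat \<Rightarrow> ennreal"
  shows "(\<Sum>i. \<Sum>j. f i j) = (\<Sum>j. \<Sum>i. f i j)"
  using nn_integral_suminf[of "\<lambda>j i. f i j" "count_space UNIV"]
  by (simp add: nn_integral_count_space_nat)

text \<open>Both sides sum \<open>w n * g k\<close> over all pairs with
  \<open>1 \<le> n \<le> k\<close>. Writing each tail as a series over all \<open>k\<close> with an
  indicator makes the interchange applicable.\<close>

lemma suminf_tail_swap:
  fixes w :: "nat \<Rightarrow> real" and g :: "nat \<Rightarrow> ennreal"
  assumes "\<And>n. 0 \<le> w n"
  shows "(\<Sum>m. ennreal (w (Suc m)) * (\<Sum>j. g (Suc m + j)))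
    = (\<Sum>k. ennreal (\<Sum>n=1..k. w n) * g k)"
proof -
  have tail: "(\<Sum>j. g (n + j)) = (\<Sum>k. if n \<le> k then g k else 0)" for n
    using suminf_ennreal_offset[of "\<lambda>k. if n \<le> k then g k else 0" n]
    by (simp add: add.commute)
  have "(\<Sum>m. ennreal (w (Suc m)) * (\<Sum>j. g (Suc m + j)))
      = (\<Sum>m. \<Sum>k. ennreal (w (Suc m)) * (if Suc m \<le> k then g k else 0))"
    unfolding tail by simp
  also have "\<dots> = (\<Sum>k. \<Sum>m. ennreal (w (Suc m)) * (if Suc m \<le> k then g k else 0))"
    by (rule suminf_ennreal_swap)
  also have "\<dots> = (\<Sum>k. ennreal (\<Sum>n=1..k. w n) * g k)"
  proof (rule suminf_cong)
    fix k
    have "(\<Sum>m. ennreal (w (Suc m)) * (if Suc m \<le> k then g k else 0))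
        = (\<Sum>m<k. ennreal (w (Suc m)) * (if Suc m \<le> k then g k else 0))"
      by (rule suminf_finite) auto
    also have "\<dots> = (\<Sum>m<k. ennreal (w (Suc m))) * g k"
      by (simp add: sum_distrib_right)
    also have "(\<Sum>m<k. ennreal (w (Suc m))) = ennreal (\<Sum>n=1..k. w n)"
      using assms by (simp add: sum_ennreal sum.atLeast1_atMost_eq)
    finally show "(\<Sum>m. ennreal (w (Suc m)) * (if Suc m \<le> k then g k else 0))
      = ennreal (\<Sum>n=1..k. w n) * g k" .
  qed
  finally show ?thesis .
qed

lemma suminf_ennreal_strict_mono:
  fixes f g :: "nat \<Rightarrow> real"
  assumes "\<And>k. 0 \<le> f k" "\<And>k. f k \<le> g k" "f i < g i" "(\<Sum>k. ennreal (g k)) < \<infinity>"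
  shows "(\<Sum>k. ennreal (f k)) < (\<Sum>k. ennreal (g k))"
proof -
  have g0: "0 \<le> g k" for k using assms(1,2) order_trans by blast
  have g: "summable g"
    using assms(4) g0 by (intro summable_suminf_not_top) auto
  have f: "summable f"
    using assms(1,2) by (intro summable_comparison_test'[OF g]) auto
  have "0 < (\<Sum>k. g k - f k)"
    using assms by (intro suminf_pos2[of _ i] summable_diff f g) auto
  then have "suminf f < suminf g" by (simp add: suminf_diff[OF g f, symmetric])
  then show ?thesis
    using assms(1) g0 f g by (simp add: suminf_ennreal2 ennreal_lessI suminf_nonneg[OF f]
      order.strict_trans1[OF suminf_nonneg[OF f]])
qed

section \<open>The two inequalities\<close>

text \<open>The first claim is the limiting form of \<open>weighted_step_sum_powr_le\<close>. The
  second holds by telescoping, because the tails \<open>A\<close> of a summable sequence tend to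
  0.\<close>

lemma ennpowr_weighted_tail_le:
  fixes c :: "nat \<Rightarrow> real"
  assumes "0 < p" "p \<le> 1" "0 \<le> t" and c: "\<And>k. 0 \<le> c k" "summable c"
  defines "A \<equiv> \<lambda>n. \<Sum>j. c (n + j)"
  shows "ennpowr (\<Sum>j. ennreal (real (n + j) powr t * c (n + j))) p
    \<le> (\<Sum>j. ennreal (real (n + j) powr (t * p) * (A (n + j) powr p - A (Suc (n + j)) powr p)))"
    (is "_ \<le> (\<Sum>j. ennreal (?g (n + j)))")
    and "(\<Sum>j. ennreal (A (n + j) powr p - A (Suc (n + j)) powr p)) = ennreal (A n powr p)"
    and "A n = c n + A (Suc n)" and "0 \<le> A n"
proof -
  have sm: "summable (\<lambda>j. c (n + j))" for n
    using summable_ignore_initial_segment[OF c(2), of n] by (simp add: add.commute)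
  have A0: "0 \<le> A n" for n
    unfolding A_def by (intro suminf_nonneg sm c)
  have AS: "A n = c n + A (Suc n)" for n
    using suminf_split_head[OF sm[of n]] by (simp add: A_def)
  then show "A n = c n + A (Suc n)" .
  show "0 \<le> A n" by (rule A0)
  have mono: "A (Suc n) \<le> A n" for n using AS[of n] c(1)[of n] by simp
  have "A = (\<lambda>n. suminf c - (\<Sum>k<n. c k))"
    using suminf_minus_initial_segment[OF c(2)] by (simp add: A_def fun_eq_iff add.commute)
  then have "A \<longlonglongrightarrow> suminf c - suminf c"
    by (simp only:) (intro tendsto_intros summable_LIMSEQ c)
  then have lim: "A \<longlonglongrightarrow> 0" by simp
  have d0: "0 \<le> A k powr p - A (Suc k) powr p" for k
    using mono A0 assms(1) by (simp add: powr_mono2)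
  have tail: "(\<Sum>j. ennreal (A (n + j) powr p - A (Suc (n + j)) powr p)) = ennreal (A n powr p)" for n
  proof (rule suminf_ennreal_eq)
    have "(\<lambda>j. A (n + j) powr p) \<longlonglongrightarrow> 0 powr p"
      using assms(1) A0 LIMSEQ_ignore_initial_segment[OF lim, of n]
      by (intro tendsto_powr') (auto simp: add.commute)
    then show "(\<lambda>j. A (n + j) powr p - A (Suc (n + j)) powr p) sums (A n powr p)"
      using telescope_sums'[of "\<lambda>j. A (n + j) powr p" 0] by simp
  qed (rule d0)
  then show "(\<Sum>j. ennreal (A (n + j) powr p - A (Suc (n + j)) powr p)) = ennreal (A n powr p)" .
  have g0: "0 \<le> ?g k" for k using d0 by simp
  show "ennpowr (\<Sum>j. ennreal (real (n + j) powr t * c (n + j))) p \<le> (\<Sum>j. ennreal (?g (n + j)))"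
  proof (rule ennpowr_suminf_le[OF assms(1)])
    fix m
    let ?rest = "real (n + m) powr (t * p) * A (n + m) powr p"
    have c_eq: "c k = A k - A (Suc k)" for k using AS[of k] by simp
    have "(\<Sum>j<m. real (n + j) powr t * c (n + j)) powr p
        \<le> ((\<Sum>j<m. real (n + j) powr t * c (n + j)) + real (n + m) powr t * A (n + m)) powr p"
      using assms(1) c A0 by (intro powr_mono2) (auto intro!: sum_nonneg)
    also have "\<dots> \<le> (\<Sum>j<m. ?g (n + j)) + ?rest"
      unfolding c_eq by (rule weighted_step_sum_powr_le[of p t A, OF assms(1-3) A0 mono])
    finally have "ennreal ((\<Sum>j<m. real (n + j) powr t * c (n + j)) powr p)
        \<le> ennreal ((\<Sum>j<m. ?g (n + j)) + ?rest)"
      by (rule ennreal_leI)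
    also have "\<dots> = ennreal (\<Sum>j<m. ?g (n + j)) + ennreal ?rest"
      by (intro ennreal_plus sum_nonneg g0) simp
    also have "ennreal (\<Sum>j<m. ?g (n + j)) = (\<Sum>j<m. ennreal (?g (n + j)))"
      by (intro sum_ennreal[symmetric] g0)
    \<comment> \<open>The remainder is expanded into the later differences of
      \<open>A powr p\<close>. Their true weights are no smaller than that at \<open>n + m\<close>,
      so it is absorbed by the rest of the series.\<close>
    also have "ennreal ?rest = (\<Sum>j. ennreal (real (n + m) powr (t * p))
        * ennreal (A (n + m + j) powr p - A (Suc (n + m + j)) powr p))"
      by (simp add: tail ennreal_mult)
    also have "\<dots> \<le> (\<Sum>j. ennreal (?g (n + (j + m))))"
    proof (rule suminf_le)
      fix j
      have "real (n + m) powr (t * p) \<le> real (n + m + j) powr (t * p)"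
        using assms by (intro powr_mono2) auto
      then show "ennreal (real (n + m) powr (t * p))
          * ennreal (A (n + m + j) powr p - A (Suc (n + m + j)) powr p) \<le> ennreal (?g (n + (j + m)))"
        using d0[of "n + m + j"]
        by (simp add: ac_simps mult_right_mono ennreal_leI flip: ennreal_mult)
    qed auto
    also have "(\<Sum>j<m. ennreal (?g (n + j))) + (\<Sum>j. ennreal (?g (n + (j + m)))) = (\<Sum>j. ennreal (?g (n + j)))"
      by (rule suminf_ennreal_offset)
    finally show "ennreal ((\<Sum>j<m. real (n + j) powr t * c (n + j)) powr p) \<le> (\<Sum>j. ennreal (?g (n + j)))"
      by (simp add: add_left_mono)
  qed (use c in auto)
qed

lemma ennpowr_tail_term:
  assumes "n \<ge> 1"
  shows "ennpowr (tail_term s a n) p = ennreal (real n powr (- (s * p)))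
    * ennpowr (\<Sum>j. ennreal (a (n + j) / real (n + j) powr (1 - s))) p"
  using assms by (simp add: tail_term_def ennpowr_cmult powr_powr)

lemma tail_coeff_shift:
  assumes "k \<ge> 1"
  shows "a k / real k powr (1 - r) = real k powr (r - s) * (a k / real k powr (1 - s))"
  using assms by (simp add: powr_diff field_simps)

text \<open>The summands of index \<open>k\<close> on the two sides differ by the factor
  \<open>(k / n) powr (r - s)\<close>, which is at least 1 because \<open>k \<ge> n\<close>.\<close>

lemma tail_term_mono:
  assumes "nonneg_seq a" "s \<le> r" "n \<ge> 1"
  shows "tail_term s a n \<le> tail_term r a n"
proof -
  have "tail_term s a n = (\<Sum>j. ennreal (real n powr (- s)) * ennreal (a (n + j) / real (n + j) powr (1 - s)))"
    by (simp add: tail_term_def)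
  also have "\<dots> \<le> (\<Sum>j. ennreal (real n powr (- r)) * ennreal (a (n + j) / real (n + j) powr (1 - r)))"
  proof (rule suminf_le)
    fix j
    define k where "k = n + j"
    have k: "1 \<le> k" "n \<le> k" using assms by (auto simp: k_def)
    have a: "0 \<le> a k" using assms(1) k by (simp add: nonneg_seq_def)
    have "real n powr (- s) = real n powr (- r) * real n powr (r - s)"
      by (simp flip: powr_add)
    also have "\<dots> \<le> real n powr (- r) * real k powr (r - s)"
      using k assms by (intro mult_left_mono powr_mono2) auto
    finally have "real n powr (- s) * (a k / real k powr (1 - s))
        \<le> real n powr (- r) * real k powr (r - s) * (a k / real k powr (1 - s))"
      using a by (intro mult_right_mono) auto
    also have "\<dots> = real n powr (- r) * (a k / real k powr (1 - r))"
      using tail_coeff_shift[OF k(1), of a r s] by simp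
    finally show "ennreal (real n powr (- s)) * ennreal (a (n + j) / real (n + j) powr (1 - s))
      \<le> ennreal (real n powr (- r)) * ennreal (a (n + j) / real (n + j) powr (1 - r))"
      using a by (simp add: ennreal_leI flip: ennreal_mult k_def)
  qed auto
  also have "\<dots> = tail_term r a n" by (simp add: tail_term_def)
  finally show ?thesis .
qed

lemma tail_sum_mono:
  assumes "nonneg_seq a" "s \<le> r" "0 \<le> p"
  shows "tail_sum p s a \<le> tail_sum p r a"
  unfolding tail_sum_def using assms by (intro suminf_le ennpowr_mono tail_term_mono) auto

text \<open>In terms of the differences \<open>d k\<close>, the sum for \<open>s\<close> is
  expressed exactly, while the sum for \<open>r\<close> is only bounded above.
  \<open>power_sum_ratio_less\<close> compares the coefficients for each \<open>k \<ge> 1\<close>;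
  strictness survives summation because some \<open>d i\<close> is positive and the sum for
  \<open>s\<close> is finite.\<close>

lemma tail_sum_less:
  assumes "0 < p" "p < 1" "s < r" "r < 1 / p" and adm: "admissible p s a"
  shows "tail_sum p r a < ennreal ((1 - s * p) / (1 - r * p)) * tail_sum p s a"
proof -
  define g b t K where "g = 1 - r * p" and "b = 1 - s * p" and "t = r - s" and "K = b / g"
  have g: "0 < g" using assms by (simp add: g_def field_simps)
  have gb: "g < b" using assms by (simp add: g_def b_def)
  have tp: "t * p = b - g" by (simp add: t_def b_def g_def algebra_simps)
  have t: "0 \<le> t" using assms by (simp add: t_def)
  have K: "0 < K" using g gb by (simp add: K_def)
  define c where "c k = a k / real k powr (1 - s)" for k
  have a: "0 \<le> a k" if "k \<ge> 1" for k
    using adm that by (simp add: admissible_def nonneg_seq_def)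
  \<comment> \<open>At \<open>k = 0\<close> the denominator is \<open>0 powr (1 - s) = 0\<close>, so
    \<open>c 0 = 0\<close> whatever the sign of \<open>a 0\<close>.\<close>
  have c: "0 \<le> c k" for k using a[of k] by (cases "k = 0") (auto simp: c_def)
  have fin: "tail_sum p s a < \<infinity>" using adm by (simp add: admissible_def)
  have s_term: "ennpowr (tail_term s a (Suc m)) p
      = ennreal (real (Suc m) powr (- (s * p))) * ennpowr (\<Sum>j. ennreal (c (Suc m + j))) p" for m
    using ennpowr_tail_term[of "Suc m" s a p] by (simp add: c_def)
  \<comment> \<open>Finiteness of the first outer term alone already forces \<open>c\<close> to be
    summable.\<close>
  have "ennpowr (tail_term s a (Suc 0)) p < \<infinity>"
    using fin unfolding tail_sum_def by (rule ennreal_suminf_lessD)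
  then have "(\<Sum>j. ennreal (c (Suc 0 + j))) \<noteq> top"
    unfolding s_term by auto
  then have "summable (\<lambda>j. c (Suc j))"
    using c by (intro summable_suminf_not_top) auto
  then have sc: "summable c" by (simp add: summable_Suc_iff)
  define A where "A n = (\<Sum>j. c (n + j))" for n
  define d where "d k = A k powr p - A (Suc k) powr p" for k
  note tail = ennpowr_weighted_tail_le[OF assms(1) less_imp_le[OF assms(2)] t c sc,
      folded A_def, folded d_def]
  have d: "0 \<le> d k" for k
    using tail(3)[of k] tail(4)[of "Suc k"] c[of k] assms(1) by (simp add: d_def powr_mono2)
  have s_sum: "tail_sum p s a = (\<Sum>k. ennreal (power_sum b k * d k))"
  proof -
    have "ennpowr (\<Sum>j. ennreal (c (n + j))) p = (\<Sum>j. ennreal (d (n + j)))" for n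
    proof -
      have "summable (\<lambda>j. c (n + j))"
        using summable_ignore_initial_segment[OF sc, of n] by (simp add: add.commute)
      then have "(\<Sum>j. ennreal (c (n + j))) = ennreal (A n)"
        unfolding A_def using c by (intro suminf_ennreal2) auto
      then show ?thesis using tail(2,4) by (simp add: ennpowr_ennreal)
    qed
    then have "tail_sum p s a = (\<Sum>m. ennreal (real (Suc m) powr (- (s * p))) * (\<Sum>j. ennreal (d (Suc m + j))))"
      unfolding tail_sum_def s_term by presburger
    also have "\<dots> = (\<Sum>k. ennreal (\<Sum>n=1..k. real n powr (- (s * p))) * ennreal (d k))"
      by (rule suminf_tail_swap) simp
    finally show ?thesis
      using d by (simp add: power_sum_def b_def sum_nonneg flip: ennreal_mult)
  qed
  have r_sum: "tail_sum p r a \<le> (\<Sum>k. ennreal (power_sum g k * (real k powr (b - g) * d k)))"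
  proof -
    have "tail_sum p r a \<le> (\<Sum>m. ennreal (real (Suc m) powr (- (r * p)))
        * (\<Sum>j. ennreal (real (Suc m + j) powr (b - g) * d (Suc m + j))))"
      unfolding tail_sum_def
    proof (rule suminf_le)
      fix m
      have "(\<lambda>j. ennreal (a (Suc m + j) / real (Suc m + j) powr (1 - r)))
          = (\<lambda>j. ennreal (real (Suc m + j) powr t * c (Suc m + j)))"
        unfolding c_def t_def by (subst tail_coeff_shift[where s = s]) auto
      then show "ennpowr (tail_term r a (Suc m)) p \<le> ennreal (real (Suc m) powr (- (r * p)))
        * (\<Sum>j. ennreal (real (Suc m + j) powr (b - g) * d (Suc m + j)))"
        using tail(1)[of "Suc m"] ennpowr_tail_term[of "Suc m" r a p]
        by (simp only: tp) (simp add: mult_left_mono)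
    qed auto
    also have "\<dots> = (\<Sum>k. ennreal (\<Sum>n=1..k. real n powr (- (r * p))) * ennreal (real k powr (b - g) * d k))"
      by (rule suminf_tail_swap) simp
    finally show ?thesis
      using d by (simp add: power_sum_def g_def sum_nonneg flip: ennreal_mult)
  qed
  have K_sum: "ennreal K * tail_sum p s a = (\<Sum>k. ennreal (K * power_sum b k * d k))"
    unfolding s_sum ennreal_suminf_cmult[symmetric]
    using K d power_sum_nonneg by (simp add: mult.assoc flip: ennreal_mult)
  obtain i where i: "i \<ge> 1" "a i \<noteq> 0" using adm by (auto simp: admissible_def)
  then have "0 < c i" using a[of i] by (simp add: c_def)
  \<comment> \<open>A nonzero coefficient makes \<open>A\<close> drop strictly at \<open>i\<close>,
    and \<open>x powr p\<close> is strictly increasing.\<close>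
  then have "0 < d i"
    using tail(3)[of i] tail(4)[of "Suc i"] assms(1) by (simp add: d_def powr_less_mono2)
  have less: "power_sum g k * (real k powr (b - g) * d k) < K * power_sum b k * d k"
    if "k \<ge> 1" "0 < d k" for k
    using mult_strict_right_mono[OF power_sum_ratio_less[OF g gb that(1)] that(2)]
    by (simp add: K_def mult_ac)
  have "(\<Sum>k. ennreal (power_sum g k * (real k powr (b - g) * d k)))
      < (\<Sum>k. ennreal (K * power_sum b k * d k))"
  proof (rule suminf_ennreal_strict_mono)
    show "power_sum g i * (real i powr (b - g) * d i) < K * power_sum b i * d i"
      using less i \<open>0 < d i\<close> by blast
    \<comment> \<open>For \<open>k = 0\<close> both power sums are empty and both sides
      vanish.\<close>
    show "power_sum g k * (real k powr (b - g) * d k) \<le> K * power_sum b k * d k" for k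
      using less[of k] d[of k] by (cases "k = 0"; cases "d k = 0") auto
    show "0 \<le> power_sum g k * (real k powr (b - g) * d k)" for k
      using d power_sum_nonneg by simp
    show "(\<Sum>k. ennreal (K * power_sum b k * d k)) < \<infinity>"
      unfolding K_sum[symmetric] using fin by (simp add: ennreal_mult_less_top)
  qed
  with r_sum show ?thesis
    by (simp add: K_sum flip: K_def g_def b_def)
qed

section \<open>Sequences with one nonzero term and optimality of the constants\<close>

lemma tail_sum_single:
  assumes "N \<ge> 1"
  shows "tail_sum p s (\<lambda>k. if k = N then 1 else 0)
    = ennreal (real N powr ((s - 1) * p) * power_sum (1 - s * p) N)"
proof -
  let ?a = "\<lambda>k. if k = N then 1 else 0 :: real"
  have atom: "ennpowr (tail_term s ?a n) p
      = (if n \<le> N then ennreal (real N powr ((s - 1) * p) * real n powr (- (s * p))) else 0)"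
    if "n \<ge> 1" for n
  proof -
    have "(\<Sum>j. ennreal (?a (n + j) / real (n + j) powr (1 - s)))
        = (\<Sum>j. if j \<in> {j. n + j = N} then ennreal (1 / real N powr (1 - s)) else 0)"
      by (intro suminf_cong) auto
    also have "\<dots> = (if n \<le> N then ennreal (1 / real N powr (1 - s)) else 0)"
    proof (cases "n \<le> N")
      case True
      then have "{j. n + j = N} = {N - n}" by auto
      then have "(\<lambda>j. if j \<in> {j. n + j = N} then ennreal (1 / real N powr (1 - s)) else 0)
          = (\<lambda>j. if j = N - n then ennreal (1 / real N powr (1 - s)) else 0)" by auto
      then show ?thesis using True
        suminf_finite[of "{N - n}" "\<lambda>j. if j = N - n then ennreal (1 / real N powr (1 - s)) else 0"]
        by simp
    next
      case False
      then have "{j. n + j = N} = {}" by auto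
      then show ?thesis using False by simp
    qed
    also have "1 / real N powr (1 - s) = real N powr (s - 1)"
      using powr_minus_divide[of "real N" "1 - s"] by simp
    finally show ?thesis
      using that by (simp add: ennpowr_tail_term ennpowr_ennreal powr_powr mult_ac
        ennpowr_def[of 0] flip: ennreal_mult)
  qed
  have "tail_sum p s ?a
      = (\<Sum>m. if Suc m \<le> N then ennreal (real N powr ((s - 1) * p) * real (Suc m) powr (- (s * p))) else 0)"
    unfolding tail_sum_def by (intro suminf_cong atom) simp
  also have "\<dots> = (\<Sum>m<N. ennreal (real N powr ((s - 1) * p) * real (Suc m) powr (- (s * p))))"
    by (subst suminf_finite[of "{..<N}"]) (auto intro!: sum.cong)
  also have "\<dots> = ennreal (real N powr ((s - 1) * p) * power_sum (1 - s * p) N)"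
    by (simp add: power_sum_def sum.atLeast1_atMost_eq sum_distrib_left sum_ennreal)
  finally show ?thesis .
qed

lemma admissible_single:
  assumes "N \<ge> 1"
  shows "admissible p s (\<lambda>k. if k = N then 1 else 0)"
  using assms by (auto simp: admissible_def nonneg_seq_def tail_sum_single)

lemma ennreal_divide_le_of_le_mult:
  assumes "ennreal x \<le> C * ennreal y" "0 < y"
  shows "ennreal (x / y) \<le> C"
  using assms by (cases C) (auto simp: divide_le_eq ennreal_le_iff simp flip: ennreal_mult)

theorem theorem4p1:
  fixes p r s :: real
  assumes "0 < p" and "p < 1" and "s < r" and "r < 1 / p"
  shows "(\<forall>a. nonneg_seq a \<longrightarrow> tail_sum p s a \<le> tail_sum p r a)
    \<and> (\<forall>a. admissible p s a \<longrightarrow>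
          tail_sum p r a < ennreal ((1 - s * p) / (1 - r * p)) * tail_sum p s a)
    \<and> (\<forall>C :: ennreal. (\<forall>a. admissible p s a \<longrightarrow> tail_sum p s a \<le> C * tail_sum p r a)
          \<longrightarrow> 1 \<le> C)
    \<and> (\<forall>C :: ennreal. (\<forall>a. admissible p s a \<longrightarrow> tail_sum p r a \<le> C * tail_sum p s a)
          \<longrightarrow> ennreal ((1 - s * p) / (1 - r * p)) \<le> C)"
proof (intro conjI allI impI)
  fix a assume "nonneg_seq a"
  then show "tail_sum p s a \<le> tail_sum p r a"
    using assms by (intro tail_sum_mono) auto
next
  fix a assume "admissible p s a"
  then show "tail_sum p r a < ennreal ((1 - s * p) / (1 - r * p)) * tail_sum p s a"
    using assms by (intro tail_sum_less)
next
  fix C :: ennreal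
  assume "\<forall>a. admissible p s a \<longrightarrow> tail_sum p s a \<le> C * tail_sum p r a"
  \<comment> \<open>For the unit mass at 1 both sums equal 1, so the first inequality is an equality
    there.\<close>
  from this[rule_format, OF admissible_single[of 1]] show "1 \<le> C"
    by (simp add: tail_sum_single power_sum_def)
next
  fix C :: ennreal
  assume C: "\<forall>a. admissible p s a \<longrightarrow> tail_sum p r a \<le> C * tail_sum p s a"
  define g b where "g = 1 - r * p" and "b = 1 - s * p"
  have g: "0 < g" using assms by (simp add: g_def field_simps)
  have b: "0 < b" using assms g mult_strict_right_mono[of s r p] unfolding g_def b_def by linarith
  have lim: "(\<lambda>n. ennreal (real (Suc n) powr (b - g) * power_sum g (Suc n) / power_sum b (Suc n)))
      \<longlonglongrightarrow> ennreal (b / g)"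
    using power_sum_ratio_tendsto[OF g b] by (rule tendsto_ennrealI)
  have "ennreal (b / g) \<le> C"
  \<comment> \<open>The unit mass at \<open>Suc n\<close> forces \<open>C\<close> to be at least the
    \<open>n\<close>-th member of a sequence that tends to \<open>b / g\<close>.\<close>
  proof (rule LIMSEQ_le_const2[OF lim], intro exI allI impI)
    fix n :: nat
    define N where "N = Suc n"
    have N: "N \<ge> 1" by (simp add: N_def)
    have "ennreal (real N powr ((r - 1) * p) * power_sum g N)
        \<le> C * ennreal (real N powr ((s - 1) * p) * power_sum b N)"
      using C[rule_format, OF admissible_single[OF N]]
      unfolding tail_sum_single[OF N] g_def b_def .
    then have "ennreal (real N powr ((r - 1) * p) * power_sum g N
        / (real N powr ((s - 1) * p) * power_sum b N)) \<le> C"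
      using N power_sum_pos[of N b] by (intro ennreal_divide_le_of_le_mult) auto
    also have "real N powr ((r - 1) * p) * power_sum g N / (real N powr ((s - 1) * p) * power_sum b N)
        = real N powr (b - g) * power_sum g N / power_sum b N"
    proof -
      have "b - g = (r - 1) * p - (s - 1) * p" by (simp add: b_def g_def algebra_simps)
      then show ?thesis by (simp add: powr_diff)
    qed
    finally show "ennreal (real (Suc n) powr (b - g) * power_sum g (Suc n) / power_sum b (Suc n)) \<le> C"
      by (simp only: N_def)
  qed
  then show "ennreal ((1 - s * p) / (1 - r * p)) \<le> C" by (simp add: g_def b_def)
qed

end
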